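(* Let $G$ be a graph of type $X$ with connectors $e_1,e_2,e_3$ (with $e_3$ an edge of the path $P(a_3,b_3)$), let $G'$ be a graph, and let $f$ be a circuit injection from $G$ onto $G'$. Then the edges $f(e_1)$ and $f(e_2)$ of $G'$ do not have a common vertex.
   Context: Graphs are undirected, finite or infinite, without loops or multiple edges; a circuit is a (finite) cycle, regarded as its set of edges. A graph of type $X$ is a graph consisting of two vertex-disjoint circuits $A$ and $B$, two edges $e_1=(a_1,b_1)$ and $e_2=(a_2,b_2)$, and a path $P(a_3,b_3)$ which shares no vertex with $A$ or $B$ except its end vertices $a_3$ and $b_3$, where $a_1,a_2,a_3$ are distinct vertices of $A$ and $b_1,b_2,b_3$ are distinct vertices of $B$; if $e_3$ is any edge of $P(a_3,b_3)$, the graph is said to be of type $X$ with connectors $e_1,e_2,e_3$. A circuit injection from $G$ onto $G'$ is a one-to-one map $f$ from the edge set of $G$ onto the edge set of $G'$ such that $f(C)$ is a circuit of $G'$ whenever $C$ is a circuit of $G$; "onto $G'$" includes the requirement that $G'$ has no isolated vertices. *)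

theory Defs
  imports Main
begin

text \<open>
  A graph is a pair of a vertex set and a set of edges, an edge being the set of its two ends; this
  excludes loops and multiple edges. Vertex and edge sets may be infinite.
\<close>

type_synonym 'a edge = "'a set"
type_synonym 'a ugraph = "'a set \<times> 'a edge set"

abbreviation verts :: "'a ugraph \<Rightarrow> 'a set" where
  "verts G \<equiv> fst G"

abbreviation edges :: "'a ugraph \<Rightarrow> 'a edge set" where
  "edges G \<equiv> snd G"

definition is_graph :: "'a ugraph \<Rightarrow> bool" where
  "is_graph G \<longleftrightarrow> (\<forall>e \<in> edges G. e \<subseteq> verts G \<and> card e = 2)"

definition no_isolated_vertices :: "'a ugraph \<Rightarrow> bool" where
  "no_isolated_vertices G \<longleftrightarrow> (\<forall>v \<in> verts G. \<exists>e \<in> edges G. v \<in> e)"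

definition path_edges :: "'a list \<Rightarrow> 'a edge set" where
  "path_edges vs = {{vs ! i, vs ! Suc i} | i. Suc i < length vs}"

definition path_between :: "'a \<Rightarrow> 'a list \<Rightarrow> 'a \<Rightarrow> bool" where
  "path_between u vs v \<longleftrightarrow> vs \<noteq> [] \<and> distinct vs \<and> hd vs = u \<and> last vs = v"

text \<open>A circuit is a finite cycle, identified with its edge set; its vertex set is the union \<open>\<Union>C\<close>.\<close>

definition is_circuit :: "'a edge set \<Rightarrow> bool" where
  "is_circuit C \<longleftrightarrow>
     (\<exists>vs. distinct vs \<and> 3 \<le> length vs \<and> C = insert {last vs, hd vs} (path_edges vs))"

definition circuit_of :: "'a ugraph \<Rightarrow> 'a edge set \<Rightarrow> bool" where
  "circuit_of G C \<longleftrightarrow> is_circuit C \<and> C \<subseteq> edges G"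

definition type_X_with_connectors :: "'a ugraph \<Rightarrow> 'a edge \<Rightarrow> 'a edge \<Rightarrow> 'a edge \<Rightarrow> bool" where
  "type_X_with_connectors G e1 e2 e3 \<longleftrightarrow>
     (\<exists>A B a1 a2 a3 b1 b2 b3 p.
        is_circuit A \<and> is_circuit B \<and> \<Union>A \<inter> \<Union>B = {} \<and>
        {a1, a2, a3} \<subseteq> \<Union>A \<and> distinct [a1, a2, a3] \<and>
        {b1, b2, b3} \<subseteq> \<Union>B \<and> distinct [b1, b2, b3] \<and>
        e1 = {a1, b1} \<and> e2 = {a2, b2} \<and>
        path_between a3 p b3 \<and> set p \<inter> (\<Union>A \<union> \<Union>B) = {a3, b3} \<and>
        e3 \<in> path_edges p \<and>
        verts G = \<Union>A \<union> \<Union>B \<union> set p \<and>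
        edges G = A \<union> B \<union> {e1, e2} \<union> path_edges p)"

definition circuit_injection ::
    "'a ugraph \<Rightarrow> 'b ugraph \<Rightarrow> ('a edge \<Rightarrow> 'b edge) \<Rightarrow> bool" where
  "circuit_injection G G' f \<longleftrightarrow>
     bij_betw f (edges G) (edges G') \<and> no_isolated_vertices G' \<and>
     (\<forall>C. circuit_of G C \<longrightarrow> circuit_of G' (f ` C))"

end

theory Submission
  imports Defs
begin

text \<open>
  Cut \<open>A\<close> at \<open>a1, a2, a3\<close> into arcs \<open>A12, A13, A23\<close>, and \<open>B\<close> likewise. A vertex \<open>w\<close> of \<open>G'\<close> has
  degree 0 or 2 in every circuit, so the set of edges \<open>e\<close> of \<open>G\<close> with \<open>w \<in> f e\<close> has 0 or 2
  elements in each of the twelve circuits of \<open>G\<close> that meet both \<open>A\<close> and \<open>B\<close>. Solving these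
  constraints shows that no \<open>w\<close> lies both on an edge of \<open>f ` A12\<close> and on an edge of \<open>f ` B12\<close>.
  If \<open>f e1\<close> and \<open>f e2\<close> had a common vertex, then removing them from the circuit
  \<open>f ` (A12 \<union> B12 \<union> {e1, e2})\<close> would leave a path composed of the nonempty sets \<open>f ` A12\<close> and
  \<open>f ` B12\<close>, and such a path contains a vertex \<open>w\<close> of both.
\<close>

section \<open>Edge sets of paths given as vertex lists\<close>

lemma path_edges_Nil [simp]: "path_edges [] = {}"
  by (simp add: path_edges_def)

lemma path_edges_single [simp]: "path_edges [x] = {}"
  by (simp add: path_edges_def)

lemma path_edges_Cons2 [simp]:
  "path_edges (x # y # zs) = insert {x, y} (path_edges (y # zs))" (is "?L = ?R")
proof
  show "?L \<subseteq> ?R"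
  proof
    fix e assume "e \<in> ?L"
    then obtain i where i: "e = {(x # y # zs) ! i, (x # y # zs) ! Suc i}" "Suc i < length (x # y # zs)"
      by (auto simp: path_edges_def)
    show "e \<in> ?R"
    proof (cases i)
      case 0
      then show ?thesis using i by simp
    next
      case (Suc j)
      then have "e = {(y # zs) ! j, (y # zs) ! Suc j}" "Suc j < length (y # zs)" using i by auto
      then show ?thesis unfolding path_edges_def by blast
    qed
  qed
  show "?R \<subseteq> ?L"
  proof
    fix e assume "e \<in> ?R"
    then consider "e = {x, y}" | j where "e = {(y # zs) ! j, (y # zs) ! Suc j}" "Suc j < length (y # zs)"
      by (auto simp: path_edges_def)
    then show "e \<in> ?L"
    proof cases
      case 1
      then show ?thesis unfolding path_edges_def by (auto intro!: exI[of _ 0])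
    next
      case 2
      then show ?thesis unfolding path_edges_def by (auto intro!: exI[of _ "Suc j"])
    qed
  qed
qed

lemma path_edges_Cons: "ys \<noteq> [] \<Longrightarrow> path_edges (x # ys) = insert {x, hd ys} (path_edges ys)"
  by (cases ys) auto

lemma path_edges_append:
  "\<lbrakk>xs \<noteq> []; ys \<noteq> []\<rbrakk> \<Longrightarrow>
    path_edges (xs @ ys) = insert {last xs, hd ys} (path_edges xs \<union> path_edges ys)"
  by (induction xs rule: induct_list012) (auto simp: path_edges_Cons)

text \<open>The cut vertex \<open>x\<close> is kept in both pieces, so no joining edge is left over.
  The lists may repeat a vertex, so closed walks around a circuit can be cut in this way
  too.\<close>

lemma path_edges_split:
  "path_edges (xs @ x # ys) = path_edges (xs @ [x]) \<union> path_edges (x # ys)"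
  by (cases "xs = []"; cases "ys = []") (auto simp: path_edges_append path_edges_Cons)

lemma path_edges_rev [simp]: "path_edges (rev xs) = path_edges xs"
proof (induction xs)
  case (Cons x xs)
  then show ?case
    by (cases "xs = []") (auto simp: path_edges_append path_edges_Cons last_rev insert_commute)
qed simp

lemma finite_path_edges [simp]: "finite (path_edges xs)"
  by (induction xs rule: induct_list012) auto

lemma path_edges_subset_set: "e \<in> path_edges xs \<Longrightarrow> e \<subseteq> set xs"
  by (induction xs rule: induct_list012) auto

lemma Union_path_edges: "2 \<le> length xs \<Longrightarrow> \<Union>(path_edges xs) = set xs"
proof (induction xs rule: induct_list012)
  case (3 x y zs)
  then show ?case by (cases zs) auto
qed auto

lemma card_path_edge: "\<lbrakk>distinct xs; e \<in> path_edges xs\<rbrakk> \<Longrightarrow> card e = 2"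
  by (induction xs rule: induct_list012) auto

lemma path_edges_disjoint:
  assumes "distinct xs" "set xs \<inter> set ys \<subseteq> {v}"
  shows "path_edges xs \<inter> path_edges ys = {}"
proof (rule ccontr)
  assume "path_edges xs \<inter> path_edges ys \<noteq> {}"
  then obtain e where e: "e \<in> path_edges xs" "e \<in> path_edges ys" by blast
  then have "e \<subseteq> {v}" using path_edges_subset_set assms(2) by blast
  then have "card e \<le> 1" using card_mono[of "{v}" e] by simp
  then show False using card_path_edge[OF assms(1) e(1)] by simp
qed

text \<open>Induction along the path. If \<open>X\<close> and \<open>Y\<close> both meet the edges
  of the tail, the induction hypothesis applies there; otherwise one of them can contain only the
  first edge while the other contains the second, and these two edges share
  \<open>y\<close>.\<close>

lemma path_edges_mixed_vertex:
  assumes "path_edges xs = X \<union> Y" "X \<noteq> {}" "Y \<noteq> {}"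
  shows "\<exists>w. w \<in> \<Union>X \<and> w \<in> \<Union>Y"
  using assms
proof (induction xs arbitrary: X Y rule: induct_list012)
  case (3 x y zs)
  show ?case
  proof (cases zs)
    case Nil
    then have "X \<union> Y = {{x, y}}" using 3(3) by simp
    then have "X = {{x, y}}" "Y = {{x, y}}" using 3(4,5) by (simp_all add: Un_singleton_iff)
    then show ?thesis by auto
  next
    case (Cons z zs')
    let ?E = "path_edges (y # zs)"
    have yz: "{y, z} \<in> ?E" using Cons by simp
    show ?thesis
    proof (cases "X \<inter> ?E = {} \<or> Y \<inter> ?E = {}")
      case True
      moreover have "X \<union> Y = insert {x, y} ?E" using 3(3) by simp
      ultimately have "X \<subseteq> {{x, y}} \<and> {y, z} \<in> Y \<or> Y \<subseteq> {{x, y}} \<and> {y, z} \<in> X"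
        using yz by blast
      then have "y \<in> \<Union>X \<and> y \<in> \<Union>Y" using 3(4,5) by (auto dest: subset_singletonD)
      then show ?thesis by blast
    next
      case False
      have "?E = (X \<inter> ?E) \<union> (Y \<inter> ?E)" using 3(3) by auto
      from "3.IH"(2)[OF this] False show ?thesis by blast
    qed
  qed
qed auto

section \<open>Circuits as cyclic lists, and the degrees of their vertices\<close>

abbreviation cycle_edges :: "'a list \<Rightarrow> 'a edge set" where
  "cycle_edges vs \<equiv> insert {last vs, hd vs} (path_edges vs)"

text \<open>Used to move any vertex of a circuit to the head of its list.\<close>

lemma cycle_edges_rotate: "cycle_edges (xs @ ys) = cycle_edges (ys @ xs)"
  by (cases "xs = []"; cases "ys = []") (auto simp: path_edges_append insert_commute)

lemma Union_cycle_edges: "3 \<le> length vs \<Longrightarrow> \<Union>(cycle_edges vs) = set vs"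
  using Union_path_edges[of vs] by (cases vs) auto

lemma circuit_at_vertex:
  assumes "is_circuit C" "v \<in> \<Union>C"
  obtains ws where "distinct (v # ws)" "2 \<le> length ws" "C = cycle_edges (v # ws)"
proof -
  obtain vs where vs: "distinct vs" "3 \<le> length vs" "C = cycle_edges vs"
    using assms(1) by (auto simp: is_circuit_def)
  then have "v \<in> set vs" using assms(2) Union_cycle_edges by blast
  then obtain xs ys where xy: "vs = xs @ v # ys" by (meson split_list)
  show ?thesis
  proof (rule that[of "ys @ xs"])
    show "C = cycle_edges (v # ys @ xs)" using vs(3) xy cycle_edges_rotate[of xs "v # ys"] by simp
  qed (use vs xy in auto)
qed

text \<open>Since \<open>v\<close> stands at the head of the list and nowhere else, its edges are
  the first one and the closing one. They differ because \<open>ws\<close> has distinct ends, and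
  deleting them opens the circuit into the path \<open>ws\<close>.\<close>

lemma circuit_edges_at:
  assumes "distinct (v # ws)" "2 \<le> length ws"
  shows "{e \<in> cycle_edges (v # ws). v \<in> e} = {{v, hd ws}, {v, last ws}}"
    and "{v, hd ws} \<noteq> {v, last ws}"
    and "cycle_edges (v # ws) - {{v, hd ws}, {v, last ws}} = path_edges ws"
proof -
  have ne: "ws \<noteq> []" using assms(2) by auto
  have *: "cycle_edges (v # ws) = {{v, hd ws}, {v, last ws}} \<union> path_edges ws"
    using ne by (auto simp: path_edges_Cons insert_commute)
  have **: "v \<notin> e" if "e \<in> path_edges ws" for e
    using path_edges_subset_set[OF that] assms(1) by auto
  show "{e \<in> cycle_edges (v # ws). v \<in> e} = {{v, hd ws}, {v, last ws}}"
    unfolding * using ** by auto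
  show "cycle_edges (v # ws) - {{v, hd ws}, {v, last ws}} = path_edges ws"
    unfolding * using ** by auto
  obtain x y zs where "ws = x # y # zs"
    using assms(2) by (metis Suc_le_length_iff numeral_2_eq_2)
  then show "{v, hd ws} \<noteq> {v, last ws}"
    using assms(1) by (auto simp: doubleton_eq_iff split: if_splits)
qed

lemma circuit_degree:
  assumes "is_circuit C"
  shows "card {e \<in> C. w \<in> e} = 0 \<or> card {e \<in> C. w \<in> e} = 2"
proof (cases "w \<in> \<Union>C")
  case True
  from circuit_at_vertex[OF assms this] obtain ws where
    ws: "distinct (w # ws)" "2 \<le> length ws" "C = cycle_edges (w # ws)" .
  then show ?thesis using circuit_edges_at[OF ws(1,2)] by simp
next
  case False
  then have "{e \<in> C. w \<in> e} = {}" by blast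
  then show ?thesis by (metis card.empty)
qed

text \<open>\<open>g\<close> and \<open>h\<close> are the only edges at \<open>v\<close>, so
  deleting them leaves a path with edge set \<open>X \<union> Y\<close>. On a path, two nonempty
  parts that together contain all edges must touch.\<close>

lemma circuit_mixed_vertex:
  assumes "is_circuit (X \<union> Y \<union> {g, h})" "g \<noteq> h" "v \<in> g" "v \<in> h"
    and "X \<inter> {g, h} = {}" "Y \<inter> {g, h} = {}" "X \<noteq> {}" "Y \<noteq> {}"
  shows "\<exists>w. w \<in> \<Union>X \<and> w \<in> \<Union>Y"
proof -
  let ?C = "X \<union> Y \<union> {g, h}"
  have "v \<in> \<Union>?C" using assms(3) by blast
  from circuit_at_vertex[OF assms(1) this] obtain ws where
    ws: "distinct (v # ws)" "2 \<le> length ws" "?C = cycle_edges (v # ws)" .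
  note at = circuit_edges_at[OF ws(1,2), folded ws(3)]
  have "g \<in> {e \<in> ?C. v \<in> e}" "h \<in> {e \<in> ?C. v \<in> e}" using assms(3,4) by auto
  then have gh: "{{v, hd ws}, {v, last ws}} = {g, h}"
    using assms(2) unfolding at(1) by blast
  have "path_edges ws = X \<union> Y"
    using at(3) assms(5,6) unfolding gh by blast
  then show ?thesis using path_edges_mixed_vertex assms(7,8) by blast
qed

section \<open>Circuits assembled from paths\<close>

lemma path_between_rev: "path_between u p v \<Longrightarrow> path_between v (rev p) u"
  by (auto simp: path_between_def hd_rev last_rev)

text \<open>The circuit runs from \<open>a\<close> along \<open>p\<close> to \<open>a'\<close>,
  along \<open>r\<close> to \<open>b'\<close>, backwards along \<open>q\<close> to \<open>b\<close>,
  and closes with the edge \<open>{a, b}\<close>. The condition \<open>a \<noteq> a'\<close>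
  supplies a third vertex besides \<open>a'\<close> and \<open>b'\<close>.\<close>

lemma circuit_from_paths:
  assumes p: "path_between a p a'" and q: "path_between b q b'" and r: "path_between a' r b'"
    and "a \<noteq> a'" "set p \<inter> set q = {}" "set r \<inter> (set p \<union> set q) = {a', b'}"
  shows "is_circuit (path_edges p \<union> path_edges q \<union> path_edges r \<union> {{a, b}})"
proof -
  have a': "a' \<in> set p" and b': "b' \<in> set q" using p q by (auto simp: path_between_def)
  then have "a' \<noteq> b'" using assms(5) by auto
  obtain p' where p': "p = p' @ [a']"
    using p by (metis append_butlast_last_id path_between_def)
  obtain q' where q': "rev q = b' # q'"
    using path_between_rev[OF q] by (metis list.collapse path_between_def)
  obtain r1 where r1: "r = a' # r1"
    using r by (metis list.collapse path_between_def)
  then have "r1 \<noteq> []" using r \<open>a' \<noteq> b'\<close> by (auto simp: path_between_def)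
  moreover from this have "last r1 = b'" using r r1 by (auto simp: path_between_def)
  ultimately obtain m where m: "r1 = m @ [b']" by (metis append_butlast_last_id)
  have "p' \<noteq> []" using p p' assms(4) by (auto simp: path_between_def)
  have sq: "set q = insert b' (set q')" using q' by (metis list.simps(15) set_rev)
  have dq: "distinct (b' # q')" using q q' by (metis distinct_rev path_between_def)
  define vs where "vs = p' @ a' # m @ b' # q'"
  have "distinct vs"
    using p r dq assms(5,6) unfolding vs_def p' r1 m sq path_between_def by auto
  moreover have "3 \<le> length vs" using \<open>p' \<noteq> []\<close> by (cases p') (auto simp: vs_def)
  moreover have "path_edges vs = path_edges p \<union> path_edges q \<union> path_edges r"
  proof -
    have "path_edges vs = path_edges p \<union> path_edges (a' # m @ b' # q')"
      unfolding vs_def p' by (rule path_edges_split)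
    also have "path_edges (a' # m @ b' # q') = path_edges r \<union> path_edges (rev q)"
      using path_edges_split[of "a' # m" b' q'] unfolding r1 m q' by simp
    finally show ?thesis by auto
  qed
  moreover have "hd vs = a"
    using p \<open>p' \<noteq> []\<close> by (simp add: vs_def p' path_between_def)
  moreover have "last vs = b"
  proof -
    have "last vs = last (rev q)" unfolding vs_def q' by simp
    then show ?thesis using q by (simp add: last_rev path_between_def)
  qed
  ultimately show ?thesis
    unfolding is_circuit_def by (intro exI[of _ vs]) (auto simp: insert_commute)
qed

section \<open>Arcs of a circuit with three marked vertices\<close>

text \<open>A path is recorded only through its edge set, so that consecutive arcs can be combined
  by union.\<close>

definition joined_by :: "'a \<Rightarrow> 'a \<Rightarrow> 'a edge set \<Rightarrow> bool" where
  "joined_by a b E \<longleftrightarrow> (\<exists>p. path_between a p b \<and> path_edges p = E)"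

lemma joined_byI:
  "\<lbrakk>distinct p; p \<noteq> []; hd p = a; last p = b; path_edges p = E\<rbrakk> \<Longrightarrow> joined_by a b E"
  by (auto simp: joined_by_def path_between_def)

lemma joined_by_sym: "joined_by a b E \<Longrightarrow> joined_by b a E"
  unfolding joined_by_def by (metis path_between_rev path_edges_rev)

lemma joined_by_finite: "joined_by a b E \<Longrightarrow> finite E"
  by (auto simp: joined_by_def)

text \<open>Distinct ends force at least one edge, and then the vertices of the path can be
  recovered from \<open>E\<close>.\<close>

lemma joined_by_path:
  assumes "joined_by a b E" "a \<noteq> b"
  obtains p where "path_between a p b" "path_edges p = E" "set p = \<Union>E"
proof -
  obtain p where p: "path_between a p b" "path_edges p = E"
    using assms(1) by (auto simp: joined_by_def)
  have "2 \<le> length p"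
    using p(1) assms(2) by (cases p; cases "tl p") (auto simp: path_between_def)
  then show ?thesis using that p Union_path_edges by blast
qed

lemma joined_by_nonempty:
  assumes "joined_by a b E" "a \<noteq> b" shows "E \<noteq> {}"
proof -
  from joined_by_path[OF assms] obtain p where "path_between a p b" "set p = \<Union>E" .
  then show ?thesis by (auto simp: path_between_def)
qed

text \<open>For each pair of marked vertices both ways around the circuit are recorded, the direct
  arc and the one through the third vertex, since both occur in circuits of a graph of type
  X.\<close>

definition circuit_arcs ::
    "'a edge set \<Rightarrow> 'a \<Rightarrow> 'a \<Rightarrow> 'a \<Rightarrow> 'a edge set \<Rightarrow> 'a edge set \<Rightarrow> 'a edge set \<Rightarrow> bool" where
  "circuit_arcs C a1 a2 a3 E12 E13 E23 \<longleftrightarrow>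
     C = E12 \<union> E13 \<union> E23 \<and> E12 \<inter> E13 = {} \<and> E12 \<inter> E23 = {} \<and> E13 \<inter> E23 = {} \<and>
     joined_by a1 a2 E12 \<and> joined_by a1 a2 (E13 \<union> E23) \<and>
     joined_by a1 a3 E13 \<and> joined_by a1 a3 (E12 \<union> E23) \<and>
     joined_by a2 a3 E23 \<and> joined_by a2 a3 (E12 \<union> E13)"

text \<open>Reduces the cyclic order \<open>a1, a3, a2\<close> to the order
  \<open>a1, a2, a3\<close>.\<close>

lemma circuit_arcs_swap:
  "circuit_arcs C a1 a3 a2 E13 E12 E23 \<Longrightarrow> circuit_arcs C a1 a2 a3 E12 E13 E23"
  unfolding circuit_arcs_def by (auto simp: Un_ac Int_commute dest: joined_by_sym)

lemma circuit_arcs_cycle: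
  assumes "distinct (a1 # u @ a2 # v @ a3 # w)"
  shows "circuit_arcs (cycle_edges (a1 # u @ a2 # v @ a3 # w)) a1 a2 a3
    (path_edges (a1 # u @ [a2])) (path_edges (a3 # w @ [a1])) (path_edges (a2 # v @ [a3]))"
    (is "circuit_arcs ?C a1 a2 a3 ?E12 ?E13 ?E23")
proof -
  have 1: "path_edges (a1 # u @ a2 # v @ [a3]) = ?E12 \<union> ?E23"
    using path_edges_split[of "a1 # u" a2 "v @ [a3]"] by simp
  have 2: "path_edges (a2 # v @ a3 # w @ [a1]) = ?E23 \<union> ?E13"
    using path_edges_split[of "a2 # v" a3 "w @ [a1]"] by simp
  have 3: "path_edges (a3 # w @ a1 # u @ [a2]) = ?E13 \<union> ?E12"
    using path_edges_split[of "a3 # w" a1 "u @ [a2]"] by simp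
  \<comment> \<open>Walking once around and back to \<open>a1\<close> traverses the three arcs and
    includes the closing edge.\<close>
  have "path_edges (a1 # u @ a2 # v @ a3 # w @ [a1]) = ?E12 \<union> ?E13 \<union> ?E23"
    using path_edges_split[of "a1 # u" a2 "v @ a3 # w @ [a1]"] 2 by auto
  moreover have "path_edges (a1 # u @ a2 # v @ a3 # w @ [a1]) = ?C"
    using path_edges_append[of "a1 # u @ a2 # v @ a3 # w" "[a1]"] by simp
  ultimately have C: "?C = ?E12 \<union> ?E13 \<union> ?E23" by simp
  have d: "?E12 \<inter> ?E13 = {}" "?E12 \<inter> ?E23 = {}" "?E13 \<inter> ?E23 = {}"
    by (rule path_edges_disjoint[where v = a1] path_edges_disjoint[where v = a2]
        path_edges_disjoint[where v = a3]; use assms in auto)+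
  have j: "joined_by a1 a2 ?E12" "joined_by a3 a1 ?E13" "joined_by a2 a3 ?E23"
    by (rule joined_byI[OF _ _ _ _ refl]; use assms in auto)+
  have k: "joined_by a1 a3 (?E12 \<union> ?E23)" "joined_by a2 a1 (?E23 \<union> ?E13)"
      "joined_by a3 a2 (?E13 \<union> ?E12)"
    using assms by (auto intro!: joined_byI[OF _ _ _ _ 1] joined_byI[OF _ _ _ _ 2]
        joined_byI[OF _ _ _ _ 3])
  show ?thesis
    unfolding circuit_arcs_def
    using C d j k j(2)[THEN joined_by_sym] k(2,3)[THEN joined_by_sym] by (simp add: Un_commute)
qed

lemma circuit_arcs_exist:
  assumes "is_circuit C" "{a1, a2, a3} \<subseteq> \<Union>C" "distinct [a1, a2, a3]"
  obtains E12 E13 E23 where "circuit_arcs C a1 a2 a3 E12 E13 E23"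
proof -
  have "a1 \<in> \<Union>C" using assms(2) by blast
  from circuit_at_vertex[OF assms(1) this] obtain ws where
    ws: "distinct (a1 # ws)" "2 \<le> length ws" "C = cycle_edges (a1 # ws)" .
  then have "\<Union>C = set (a1 # ws)" using Union_cycle_edges[of "a1 # ws"] by simp
  then have a2: "a2 \<in> set ws" and a3: "a3 \<in> set ws" using assms(2,3) by auto
  obtain xs ys where xy: "ws = xs @ a2 # ys" using a2 by (meson split_list)
  then consider "a3 \<in> set ys" | "a3 \<in> set xs" using a3 assms(3) by auto
  then show ?thesis
  proof cases
    case 1
    then obtain v w where "ys = v @ a3 # w" by (meson split_list)
    then have eq: "ws = xs @ a2 # v @ a3 # w" using xy by simp
    show ?thesis
      using circuit_arcs_cycle[OF ws(1)[unfolded eq], folded eq, folded ws(3)] by (rule that)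
  next
    case 2
    then obtain u v where "xs = u @ a3 # v" by (meson split_list)
    then have eq: "ws = u @ a3 # v @ a2 # ys" using xy by simp
    show ?thesis
      using circuit_arcs_cycle[OF ws(1)[unfolded eq], folded eq, folded ws(3)]
      by (rule that[OF circuit_arcs_swap])
  qed
qed

text \<open>Edge-set form of \<open>circuit_from_paths\<close>. It is applied with \<open>U\<close>
  and \<open>V\<close> the vertex sets of \<open>A\<close> and \<open>B\<close>, and with
  \<open>R\<close> either the path \<open>P\<close> or the single edge \<open>e2\<close>.\<close>

lemma circuit_through_connectors:
  assumes "joined_by a a' E" "joined_by b b' F" "joined_by a' b' R"
    and "a \<noteq> a'" "b \<noteq> b'" "\<Union>E \<subseteq> U" "\<Union>F \<subseteq> V" "U \<inter> V = {}" "\<Union>R \<inter> (U \<union> V) = {a', b'}"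
  shows "is_circuit (E \<union> F \<union> R \<union> {{a, b}})"
proof -
  obtain p where p: "path_between a p a'" "path_edges p = E" "set p = \<Union>E"
    using joined_by_path assms(1,4) .
  obtain q where q: "path_between b q b'" "path_edges q = F" "set q = \<Union>F"
    using joined_by_path assms(2,5) .
  have in_p: "a' \<in> set p" and in_q: "b' \<in> set q" using p(1) q(1) by (auto simp: path_between_def)
  then have "a' \<noteq> b'" using p(3) q(3) assms(6-8) by blast
  then obtain r where r: "path_between a' r b'" "path_edges r = R" "set r = \<Union>R"
    using joined_by_path assms(3) by metis
  have "a' \<in> set r" "b' \<in> set r" using r(1) by (auto simp: path_between_def)
  then have "set r \<inter> (set p \<union> set q) = {a', b'}"
    using in_p in_q p(3) q(3) r(3) assms(6-9) by blast
  moreover have "set p \<inter> set q = {}" using p(3) q(3) assms(6-8) by blast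
  ultimately show ?thesis
    using circuit_from_paths[OF p(1) q(1) r(1) assms(4)] p(2) q(2) r(2) by simp
qed

section \<open>Arithmetic of edge counts at a vertex\<close>

lemma card_Int_Un_disjoint:
  assumes "finite X" "finite Y" "X \<inter> Y = {}"
  shows "card (N \<inter> (X \<union> Y)) = card (N \<inter> X) + card (N \<inter> Y)"
  using assms by (subst Int_Un_distrib, subst card_Un_disjoint) auto

text \<open>Here \<open>x\<close>, \<open>y\<close>, \<open>p\<close>, \<open>e\<close> count the edges at a vertex of \<open>G'\<close> in the images of the arcs of
  \<open>A\<close>, the arcs of \<open>B\<close>, the path \<open>P\<close>, and the edges \<open>e1\<close>, \<open>e2\<close>.\<close>

lemma circuit_counts_infeasible:
  fixes x12 x13 x23 y12 y13 y23 p e1 e2 :: nat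
  defines "deg \<equiv> \<lambda>n::nat. n = 0 \<or> n = 2"
  assumes "deg (x12 + y12 + e2 + e1)" "deg (x12 + (y13 + y23) + e2 + e1)"
    "deg ((x13 + x23) + y12 + e2 + e1)"
    and "deg (x13 + y13 + p + e1)" "deg (x13 + (y12 + y23) + p + e1)"
    "deg ((x12 + x23) + y13 + p + e1)" "deg ((x12 + x23) + (y12 + y23) + p + e1)"
    and "deg (x23 + y23 + p + e2)" "deg (x23 + (y12 + y13) + p + e2)"
    "deg ((x12 + x13) + y23 + p + e2)" "deg ((x12 + x13) + (y12 + y13) + p + e2)"
    and "x12 \<noteq> 0" "y12 \<noteq> 0"
  shows False
proof -
  \<comment> \<open>Two positive summands already exhaust the bound 2.\<close>
  have 1: "x12 = 1" "y12 = 1" "e1 = 0" "e2 = 0" using assms(2,13,14) unfolding deg_def by auto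
  have "y13 + y23 = 1" "x13 + x23 = 1" using assms(3,4) 1 unfolding deg_def by auto
  then have "(x13 = 0 \<and> x23 = 1 \<or> x13 = 1 \<and> x23 = 0) \<and> (y13 = 0 \<and> y23 = 1 \<or> y13 = 1 \<and> y23 = 0)"
    by linarith
  \<comment> \<open>In each of the four cases some circuit through the path has count at least
    3.\<close>
  then show False using assms(5-12) 1 unfolding deg_def by auto
qed

section \<open>Incidences in the image of a graph of type X\<close>

theorem theorem5:
  fixes G :: "'a ugraph" and G' :: "'b ugraph" and f :: "'a edge \<Rightarrow> 'b edge"
  assumes "is_graph G"
    and "type_X_with_connectors G e1 e2 e3"
    and "is_graph G'"
    and "circuit_injection G G' f"
  shows "\<not> (\<exists>v \<in> verts G'. v \<in> f e1 \<and> v \<in> f e2)"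
proof
  assume "\<exists>v \<in> verts G'. v \<in> f e1 \<and> v \<in> f e2"
  then obtain v where v: "v \<in> f e1" "v \<in> f e2" by blast
  from assms(2)[unfolded type_X_with_connectors_def]
  obtain A B a1 a2 a3 b1 b2 b3 p where
    A: "is_circuit A" and B: "is_circuit B" and AB: "\<Union>A \<inter> \<Union>B = {}"
    and a: "{a1, a2, a3} \<subseteq> \<Union>A" "distinct [a1, a2, a3]"
    and b: "{b1, b2, b3} \<subseteq> \<Union>B" "distinct [b1, b2, b3]"
    and e: "e1 = {a1, b1}" "e2 = {a2, b2}"
    and p: "path_between a3 p b3" "set p \<inter> (\<Union>A \<union> \<Union>B) = {a3, b3}"
    and G: "edges G = A \<union> B \<union> {e1, e2} \<union> path_edges p"
    by (elim exE conjE) (rule that)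
  obtain A12 A13 A23 where arcsA: "circuit_arcs A a1 a2 a3 A12 A13 A23"
    using circuit_arcs_exist[OF A a] .
  obtain B12 B13 B23 where arcsB: "circuit_arcs B b1 b2 b3 B12 B13 B23"
    using circuit_arcs_exist[OF B b] .
  note arcs = arcsA[unfolded circuit_arcs_def] arcsB[unfolded circuit_arcs_def]
  define P where "P = path_edges p"
  have ab: "{a1, a2, a3} \<inter> {b1, b2, b3} = {}" using a(1) b(1) AB by blast
  have P: "joined_by a3 b3 P" using p(1) by (auto simp: joined_by_def P_def)
  have UP: "\<Union>P = set p"
  proof -
    have "2 \<le> length p"
      using p(1) ab by (cases p; cases "tl p") (auto simp: path_between_def)
    then show ?thesis unfolding P_def by (rule Union_path_edges)
  qed
  \<comment> \<open>Seen as a path, \<open>e2\<close> can take the place of \<open>P\<close> in the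
    circuits through both \<open>e1\<close> and \<open>e2\<close>.\<close>
  have e2_path: "joined_by a2 b2 {e2}"
    using ab e by (intro joined_byI[of "[a2, b2]"]) auto
  have inj: "inj_on f (edges G)" using assms(4) by (auto simp: circuit_injection_def bij_betw_def)

  \<comment> \<open>Counts over arcs, connecting edges and \<open>P\<close> will be added, which
    requires these pieces to be disjoint.\<close>
  have disj: "A \<inter> B = {}" "A \<inter> P = {}" "B \<inter> P = {}" "e1 \<notin> A" "e2 \<notin> A" "e1 \<notin> B" "e2 \<notin> B"
    "e1 \<notin> P" "e2 \<notin> P" "e1 \<noteq> e2"
  proof -
    have edge2: "card c = 2" if "c \<in> A \<union> B" for c
      using that assms(1) G by (auto simp: is_graph_def)
    show "A \<inter> B = {}"
    proof (rule ccontr)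
      assume "A \<inter> B \<noteq> {}"
      then obtain c where c: "c \<in> A" "c \<in> B" by blast
      then have "c = {}" using AB by blast
      then show False using edge2 c by force
    qed
    \<comment> \<open>\<open>P\<close> shares only one vertex with each circuit, and an edge needs
      two.\<close>
    have "c \<notin> P" if "c \<in> A \<union> B" for c
    proof
      assume "c \<in> P"
      then have "c \<subseteq> set p" using UP by blast
      moreover have "c \<subseteq> \<Union>A \<or> c \<subseteq> \<Union>B" using that by blast
      moreover have "set p \<inter> \<Union>A \<subseteq> {a3}" "set p \<inter> \<Union>B \<subseteq> {b3}"
        using p(2) a(1) b(1) AB by auto
      ultimately have "c \<subseteq> {a3} \<or> c \<subseteq> {b3}" by blast
      then have "card c \<le> 1" using card_mono[of "{_}" c] by fastforce
      then show False using edge2[OF that] by simp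
    qed
    then show "A \<inter> P = {}" "B \<inter> P = {}" by auto
    show "e1 \<notin> A" "e2 \<notin> A" "e1 \<notin> B" "e2 \<notin> B" using a(1) b(1) AB unfolding e by blast+
    have "a1 \<notin> set p" "a2 \<notin> set p" using p(2) a b(1) ab by auto
    then show "e1 \<notin> P" "e2 \<notin> P" using UP unfolding e by auto
    show "e1 \<noteq> e2" unfolding e using a(2) ab by (auto simp: doubleton_eq_iff)
  qed
  have arcA: "A = A12 \<union> A13 \<union> A23" and arcB: "B = B12 \<union> B13 \<union> B23"
    using arcs by simp_all
  have sub: "A12 \<subseteq> A" "A13 \<subseteq> A" "A23 \<subseteq> A" "B12 \<subseteq> B" "B13 \<subseteq> B" "B23 \<subseteq> B"
    unfolding arcA arcB by blast+
  have jA: "joined_by a1 a2 A12" "joined_by a1 a2 (A13 \<union> A23)" "joined_by a1 a3 A13"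
    "joined_by a1 a3 (A12 \<union> A23)" "joined_by a2 a3 A23" "joined_by a2 a3 (A12 \<union> A13)"
    and jB: "joined_by b1 b2 B12" "joined_by b1 b2 (B13 \<union> B23)" "joined_by b1 b3 B13"
    "joined_by b1 b3 (B12 \<union> B23)" "joined_by b2 b3 B23" "joined_by b2 b3 (B12 \<union> B13)"
    using arcs by simp_all
  have fin: "finite A12" "finite A13" "finite A23" "finite B12" "finite B13" "finite B23" "finite P"
    using P jA(1,3,5) jB(1,3,5) by (auto intro: joined_by_finite)
  then have finAB: "finite A" "finite B" unfolding arcA arcB by simp_all

  \<comment> \<open>A circuit meeting both \<open>A\<close> and \<open>B\<close> uses two of the
    three links \<open>e1\<close>, \<open>e2\<close>, \<open>P\<close>. In each of the three choices
    \<open>E\<close> and \<open>F\<close> may be either of the two ways around between the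
    attachment vertices.\<close>
  have circ12: "is_circuit (E \<union> F \<union> {e2} \<union> {e1})"
    if "joined_by a1 a2 E" "joined_by b1 b2 F" "E \<subseteq> A" "F \<subseteq> B" for E F
    unfolding e(1)
    by (rule circuit_through_connectors[OF that(1,2) e2_path, where U = "\<Union>A" and V = "\<Union>B"])
      (use a b AB that(3,4) e in auto)
  have circ13: "is_circuit (E \<union> F \<union> P \<union> {e1})"
    if "joined_by a1 a3 E" "joined_by b1 b3 F" "E \<subseteq> A" "F \<subseteq> B" for E F
    unfolding e(1)
    by (rule circuit_through_connectors[OF that(1,2) P, where U = "\<Union>A" and V = "\<Union>B"])
      (use a b AB that(3,4) p(2) UP in auto)
  have circ23: "is_circuit (E \<union> F \<union> P \<union> {e2})"
    if "joined_by a2 a3 E" "joined_by b2 b3 F" "E \<subseteq> A" "F \<subseteq> B" for E F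
    unfolding e(2)
    by (rule circuit_through_connectors[OF that(1,2) P, where U = "\<Union>A" and V = "\<Union>B"])
      (use a b AB that(3,4) p(2) UP in auto)

  have image_circuit: "is_circuit (f ` C)" if "is_circuit C" "C \<subseteq> edges G" for C
    using assms(4) that by (auto simp: circuit_injection_def circuit_of_def)

  have separated: False if "w \<in> \<Union>(f ` A12)" "w \<in> \<Union>(f ` B12)" for w
  proof -
    define N where "N = {c. w \<in> f c}"
    define n where "n = (\<lambda>X. card (N \<inter> X))"
    have deg: "n C = 0 \<or> n C = 2" if C: "is_circuit C" "C \<subseteq> edges G" for C
    proof -
      \<comment> \<open>Injectivity of \<open>f\<close> makes \<open>n C\<close> the degree of
        \<open>w\<close> in the image circuit.\<close>
      have "{c \<in> f ` C. w \<in> c} = f ` (N \<inter> C)" by (auto simp: N_def)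
      moreover have "inj_on f (N \<inter> C)" using inj C(2) by (auto intro: inj_on_subset)
      ultimately show ?thesis
        using circuit_degree[OF image_circuit[OF C], of w] by (simp add: n_def card_image)
    qed
    have n_Un: "n (X \<union> Y) = n X + n Y" if "finite X" "finite Y" "X \<inter> Y = {}" for X Y
      unfolding n_def using that by (rule card_Int_Un_disjoint)
    \<comment> \<open>The disjunction on \<open>R\<close> and \<open>c\<close> lists the three kinds
      of circuit: through \<open>P\<close> and \<open>e1\<close>, through \<open>P\<close> and
      \<open>e2\<close>, through \<open>e1\<close> and \<open>e2\<close>.\<close>
    have sum4: "n (E \<union> F \<union> R \<union> {c}) = n E + n F + n R + n {c}"
      if "E \<subseteq> A" "F \<subseteq> B" "R = P \<and> c \<in> {e1, e2} \<or> R = {e2} \<and> c = e1" for E F R c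
    proof -
      have "finite E" "finite F" "finite R"
        using that fin(7) finAB by (auto intro: finite_subset)
      moreover have "E \<inter> F = {}" "(E \<union> F) \<inter> R = {}" "(E \<union> F \<union> R) \<inter> {c} = {}"
        using that disj by auto
      ultimately show ?thesis by (simp only: n_Un finite_Un finite.emptyI finite_insert)
    qed
    have sum2: "n (A13 \<union> A23) = n A13 + n A23" "n (A12 \<union> A23) = n A12 + n A23"
      "n (A12 \<union> A13) = n A12 + n A13" "n (B13 \<union> B23) = n B13 + n B23"
      "n (B12 \<union> B23) = n B12 + n B23" "n (B12 \<union> B13) = n B12 + n B13"
      using arcs fin by (simp_all only: n_Un)
    have deg12: "n E + n F + n {e2} + n {e1} = 0 \<or> n E + n F + n {e2} + n {e1} = 2"
      if "joined_by a1 a2 E" "joined_by b1 b2 F" "E \<subseteq> A" "F \<subseteq> B" for E F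
    proof -
      have "E \<union> F \<union> {e2} \<union> {e1} \<subseteq> edges G" using that(3,4) G unfolding P_def by blast
      from deg[OF circ12[OF that] this] show ?thesis
        using sum4[OF that(3,4), of "{e2}" e1] by simp
    qed
    have deg13: "n E + n F + n P + n {e1} = 0 \<or> n E + n F + n P + n {e1} = 2"
      if "joined_by a1 a3 E" "joined_by b1 b3 F" "E \<subseteq> A" "F \<subseteq> B" for E F
    proof -
      have "E \<union> F \<union> P \<union> {e1} \<subseteq> edges G" using that(3,4) G unfolding P_def by blast
      from deg[OF circ13[OF that] this] show ?thesis
        using sum4[OF that(3,4), of "P" e1] by simp
    qed
    have deg23: "n E + n F + n P + n {e2} = 0 \<or> n E + n F + n P + n {e2} = 2"
      if "joined_by a2 a3 E" "joined_by b2 b3 F" "E \<subseteq> A" "F \<subseteq> B" for E F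
    proof -
      have "E \<union> F \<union> P \<union> {e2} \<subseteq> edges G" using that(3,4) G unfolding P_def by blast
      from deg[OF circ23[OF that] this] show ?thesis
        using sum4[OF that(3,4), of "P" e2] by simp
    qed
    \<comment> \<open>Finiteness of the arcs is what turns an edge at \<open>w\<close> into a
      nonzero cardinality.\<close>
    have nz: "n A12 \<noteq> 0" "n B12 \<noteq> 0" using that fin by (auto simp: n_def N_def)
    \<comment> \<open>Folding \<open>sum2\<close> rewrites the sums of arc counts in the arithmetic
      lemma as counts of composite arcs, the form in which the degree facts are available.\<close>
    show False
      by (rule circuit_counts_infeasible[of "n A12" "n B12" "n {e2}" "n {e1}" "n B13" "n B23"
          "n A13" "n A23" "n P", folded sum2,
          OF deg12[OF jA(1) jB(1)] deg12[OF jA(1) jB(2)] deg12[OF jA(2) jB(1)]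
            deg13[OF jA(3) jB(3)] deg13[OF jA(3) jB(4)] deg13[OF jA(4) jB(3)]
            deg13[OF jA(4) jB(4)]
            deg23[OF jA(5) jB(5)] deg23[OF jA(5) jB(6)] deg23[OF jA(6) jB(5)]
            deg23[OF jA(6) jB(6)]])
        (use sub nz in simp_all)
  qed

  have ne: "A12 \<noteq> {}" "B12 \<noteq> {}"
    using joined_by_nonempty[OF jA(1)] joined_by_nonempty[OF jB(1)] a(2) b(2) by auto
  have "is_circuit (f ` (A12 \<union> B12 \<union> {e2} \<union> {e1}))"
    using jA(1) jB(1) sub G by (intro image_circuit circ12) auto
  then have "is_circuit (f ` A12 \<union> f ` B12 \<union> {f e1, f e2})"
    by (simp add: image_Un insert_commute)
  moreover have "f e1 \<noteq> f e2"
    using inj G disj(10) by (auto dest: inj_onD)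
  \<comment> \<open>By injectivity \<open>f e1\<close> and \<open>f e2\<close> are not among the
    images of the arcs, so deleting them at \<open>v\<close> leaves both images whole.\<close>
  moreover have "f ` X \<inter> {f e1, f e2} = {}" if "X \<subseteq> A \<union> B" for X
  proof -
    have "X \<subseteq> edges G" "e1 \<in> edges G" "e2 \<in> edges G" using that G by auto
    moreover have "e1 \<notin> X" "e2 \<notin> X" using that disj by auto
    ultimately show ?thesis using inj by (auto simp: inj_on_def subset_iff)
  qed
  then have "f ` A12 \<inter> {f e1, f e2} = {}" "f ` B12 \<inter> {f e1, f e2} = {}"
    using sub(1,4) by (meson le_supI1 le_supI2)+
  ultimately have "\<exists>w. w \<in> \<Union>(f ` A12) \<and> w \<in> \<Union>(f ` B12)"
    using v ne by (intro circuit_mixed_vertex) auto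
  then show False using separated by blast
qed

end
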